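(* Let $(R,S)$ be a generalized Rota-Baxter system on an $A$-bimodule $M$ over an associative algebra $A$. If $(R_t=\sum_{i\ge0}t^iR_i,\ S_t=\sum_{i\ge0}t^iS_i)$ is a formal one-parameter deformation of $(R,S)$, then its infinitesimal $(R_1,S_1)$ is a $1$-cocycle in the cohomology of $(R,S)$, and its class in $H^1(M,A)$ depends only on the equivalence class of the deformation; that is, if $(R_t,S_t)$ and $(R'_t,S'_t)$ are equivalent formal one-parameter deformations of $(R,S)$, then $(R_1,S_1)$ and $(R'_1,S'_1)$ define the same class in $H^1(M,A)$.
   Context: All vector spaces are over a field $\mathbb{K}$ of characteristic zero. A generalized Rota-Baxter system on an $A$-bimodule $M$ over $A$ is a pair of linear maps $R,S:M\to A$ with $R(u)R(v)=R(R(u)\cdot v+u\cdot S(v))$ and $S(u)S(v)=S(R(u)\cdot v+u\cdot S(v))$ for all $u,v\in M$. Morphisms: a morphism from $(R,S)$ (on an $A$-bimodule $M$) to $(R',S')$ (on an $A'$-bimodule $M'$) is a triple $(\phi,\varphi,\psi)$ of algebra maps $\phi,\varphi:A\to A'$ and a linear map $\psi:M\to M'$ with $R'\circ\psi=\phi\circ R$, $S'\circ\psi=\varphi\circ S$, $\psi(a\cdot u)=\phi(a)\cdot\psi(u)$, $\psi(u\cdot a)=\psi(u)\cdot\varphi(a)$. Deformations: $A[[t]]$ is an algebra and $M[[t]]$ an $A[[t]]$-bimodule by $\mathbb{K}[[t]]$-bilinearity. A formal one-parameter deformation of $(R,S)$ is a pair of formal sums $R_t=\sum_{i\ge 0}t^iR_i$,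 $S_t=\sum_{i\ge0}t^iS_i$ in $\mathrm{Hom}(M,A)[[t]]$ with $R_0=R$, $S_0=S$ such that $(R_t,S_t)$ is a generalized Rota-Baxter system on $M[[t]]$ over $A[[t]]$. Its infinitesimal is $(R_1,S_1)$. Two deformations $(R_t,S_t)$, $(R'_t,S'_t)$ are equivalent if there exist $a,b\in A$ and linear maps $\phi_i,\varphi_i\in\mathrm{End}(A)$, $\psi_i\in\mathrm{End}(M)$ ($i\ge2$) such that, with $\phi_t=\mathrm{id}_A+t(l^{\mathrm{ad}}_a-r^{\mathrm{ad}}_a)+\sum_{i\ge2}t^i\phi_i$, $\varphi_t=\mathrm{id}_A+t(l^{\mathrm{ad}}_b-r^{\mathrm{ad}}_b)+\sum_{i\ge2}t^i\varphi_i$, $\psi_t=\mathrm{id}_M+t(l_a-r_b)+\sum_{i\ge2}t^i\psi_i$, the triple $(\phi_t,\varphi_t,\psi_t)$ is a morphism of generalized Rota-Baxter systems from $(R_t,S_t)$ to $(R'_t,S'_t)$. Here $l^{\mathrm{ad}}_a(x)=ax$, $r^{\mathrm{ad}}_a(x)=xa$, $l_a(u)=a\cdot u$, $r_b(u)=u\cdot b$. Cohomology: for $F=(F_1,F_2)\in\mathrm{Hom}(M^{\otimes m},A\oplus A)$ and $G=(G_1,G_2)\in\mathrm{Hom}(M^{\otimes n},A\oplus A)$, $m,n\ge0$, $\llbracket F,G\rrbracket\in\mathrm{Hom}(M^{\otimes(m+n)},A\oplus A)$ has components, $k=1,2$, \begin{align*} \llbracket F,G\rrbracket_k(u_1,\dots,u_{m+n})=&\sum_{i=1}^m(-1)^{(i-1)n}F_k(u_1,\dots,u_{i-1},G_1(u_i,\dots,u_{i+n-1})\cdot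 u_{i+n},\dots,u_{m+n})\\ &-\sum_{i=1}^m(-1)^{in}F_k(u_1,\dots,u_{i-1},u_i\cdot G_2(u_{i+1},\dots,u_{i+n}),u_{i+n+1},\dots,u_{m+n})\\ &-(-1)^{mn}\Big\{\sum_{i=1}^n(-1)^{(i-1)m}G_k(u_1,\dots,u_{i-1},F_1(u_i,\dots,u_{i+m-1})\cdot u_{i+m},\dots,u_{m+n})\\ &\qquad-\sum_{i=1}^n(-1)^{im}G_k(u_1,\dots,u_{i-1},u_i\cdot F_2(u_{i+1},\dots,u_{i+m}),u_{i+m+1},\dots,u_{m+n})\Big\}\\ &+(-1)^{mn}\big[F_k(u_1,\dots,u_m)G_k(u_{m+1},\dots,u_{m+n})-(-1)^{mn}G_k(u_1,\dots,u_n)F_k(u_{n+1},\dots,u_{m+n})\big]. \end{align*} The cohomology $H^\bullet(M,A)$ of $(R,S)$ is that of the cochain complex $C^n(M,A)=\mathrm{Hom}(M^{\otimes n},A\oplus A)$, $n\ge0$, with differential $d_{(R,S)}=\llbracket(R,S),\cdot\rrbracket$. *)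

theory Defs
  imports
    "HOL-Computational_Algebra.Formal_Power_Series"
    "HOL-Library.Product_Plus"
    "HOL-Library.Function_Algebras"
    "HOL-Library.Set_Algebras"
begin

unbundle fps_syntax

section \<open>Algebras, bimodules and generalized Rota-Baxter systems\<close>

text \<open>
  The scalars form a commutative ring with one, so that the same notions apply over a field
  and over the ring of formal power series over that field. Algebras need not have a unit.
\<close>

locale assoc_algebra = module sclA
  for sclA :: "'k::comm_ring_1 \<Rightarrow> 'a::ring \<Rightarrow> 'a" +
  assumes scl_mult_left: "sclA c x * y = sclA c (x * y)"
    and scl_mult_right: "x * sclA c y = sclA c (x * y)"

locale algebra_bimodule = alg: assoc_algebra sclA + mdl: module sclM
  for sclA :: "'k::comm_ring_1 \<Rightarrow> 'a::ring \<Rightarrow> 'a"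
    and sclM :: "'k \<Rightarrow> 'm::ab_group_add \<Rightarrow> 'm" +
  fixes lact :: "'a \<Rightarrow> 'm \<Rightarrow> 'm" and ract :: "'m \<Rightarrow> 'a \<Rightarrow> 'm"
  assumes lact_add_left: "lact (a + b) u = lact a u + lact b u"
    and lact_add_right: "lact a (u + v) = lact a u + lact a v"
    and lact_scl_left: "lact (sclA c a) u = sclM c (lact a u)"
    and lact_scl_right: "lact a (sclM c u) = sclM c (lact a u)"
    and ract_add_left: "ract (u + v) a = ract u a + ract v a"
    and ract_add_right: "ract u (a + b) = ract u a + ract u b"
    and ract_scl_left: "ract (sclM c u) a = sclM c (ract u a)"
    and ract_scl_right: "ract u (sclA c a) = sclM c (ract u a)"
    and lact_mult: "lact (a * b) u = lact a (lact b u)"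
    and ract_mult: "ract u (a * b) = ract (ract u a) b"
    and lact_ract: "ract (lact a u) b = lact a (ract u b)"

locale grb_system = algebra_bimodule sclA sclM lact ract
  for sclA :: "'k::comm_ring_1 \<Rightarrow> 'a::ring \<Rightarrow> 'a"
    and sclM :: "'k \<Rightarrow> 'm::ab_group_add \<Rightarrow> 'm"
    and lact :: "'a \<Rightarrow> 'm \<Rightarrow> 'm" and ract :: "'m \<Rightarrow> 'a \<Rightarrow> 'm" +
  fixes R S :: "'m \<Rightarrow> 'a"
  assumes linear_R: "module_hom sclM sclA R"
    and linear_S: "module_hom sclM sclA S"
    and R_mult: "R u * R v = R (lact (R u) v + ract u (S v))"
    and S_mult: "S u * S v = S (lact (R u) v + ract u (S v))"

locale grb_morphism =
  src: grb_system sclA sclM lact ract R S + tgt: grb_system sclA' sclM' lact' ract' R' S'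
  for sclA :: "'k::comm_ring_1 \<Rightarrow> 'a::ring \<Rightarrow> 'a"
    and sclM :: "'k \<Rightarrow> 'm::ab_group_add \<Rightarrow> 'm"
    and lact ract R S
    and sclA' :: "'k \<Rightarrow> 'b::ring \<Rightarrow> 'b"
    and sclM' :: "'k \<Rightarrow> 'n::ab_group_add \<Rightarrow> 'n"
    and lact' ract' R' S' +
  fixes \<phi> \<phi>' :: "'a \<Rightarrow> 'b" and \<psi> :: "'m \<Rightarrow> 'n"
  assumes linear_phi: "module_hom sclA sclA' \<phi>"
    and mult_phi: "\<phi> (x * y) = \<phi> x * \<phi> y"
    and linear_phi': "module_hom sclA sclA' \<phi>'"
    and mult_phi': "\<phi>' (x * y) = \<phi>' x * \<phi>' y"
    and linear_psi: "module_hom sclM sclM' \<psi>"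
    and R_psi: "R' (\<psi> u) = \<phi> (R u)"
    and S_psi: "S' (\<psi> u) = \<phi>' (S u)"
    and psi_lact: "\<psi> (lact a u) = lact' (\<phi> a) (\<psi> u)"
    and psi_ract: "\<psi> (ract u a) = ract' (\<psi> u) (\<phi>' a)"


section \<open>Extension to formal power series\<close>

text \<open>
  The Cauchy product attached to a biadditive operation. It turns the scalar
  multiplications and the two actions over \<open>K\<close> into those over \<open>K[[t]]\<close>. The product
  of \<open>A[[t]]\<close> itself is the library product on \<^typ>\<open>'a::ring fps\<close>.
\<close>

definition fps_bilin :: "('a \<Rightarrow> 'b \<Rightarrow> 'c::comm_monoid_add) \<Rightarrow> 'a fps \<Rightarrow> 'b fps \<Rightarrow> 'c fps"
  where "fps_bilin f x y = Abs_fps (\<lambda>n. \<Sum>i=0..n. f (x $ i) (y $ (n - i)))"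

text \<open>
  The \<open>K[[t]]\<close>-linear map between spaces of power series that a formal sum of linear maps
  (a power series whose coefficients are maps) determines.
\<close>

definition fps_ext :: "('a \<Rightarrow> 'b::comm_monoid_add) fps \<Rightarrow> 'a fps \<Rightarrow> 'b fps"
  where "fps_ext F = fps_bilin (\<lambda>f x. f x) F"

lemma fps_bilin_nth: "fps_bilin f x y $ n = (\<Sum>i=0..n. f (x $ i) (y $ (n - i)))"
  by (simp add: fps_bilin_def)

lemma fps_ext_nth: "fps_ext F x $ n = (\<Sum>i=0..n. (F $ i) (x $ (n - i)))"
  by (simp add: fps_ext_def fps_bilin_nth)

lemma fps_bilin_times: "fps_bilin (*) x y = x * y"
  by (simp add: fps_eq_iff fps_bilin_nth fps_mult_nth)

lemma fps_bilin_assoc: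
  fixes f :: "'a::comm_monoid_add \<Rightarrow> 'b::comm_monoid_add \<Rightarrow> 'c::comm_monoid_add"
    and g :: "'c \<Rightarrow> 'd::comm_monoid_add \<Rightarrow> 'e::cancel_comm_monoid_add"
    and h :: "'a \<Rightarrow> 'g::comm_monoid_add \<Rightarrow> 'e"
    and k :: "'b \<Rightarrow> 'd \<Rightarrow> 'g"
  assumes add: "\<And>x y z. g (x + y) z = g x z + g y z" "\<And>x y z. h x (y + z) = h x y + h x z"
    and assoc: "\<And>x y z. g (f x y) z = h x (k y z)"
  shows "fps_bilin g (fps_bilin f x y) z = fps_bilin h x (fps_bilin k y z)"
proof -
  have g0: "g 0 w = 0" for w using add(1)[of 0 0 w] by simp
  have h0: "h w 0 = 0" for w using add(2)[of w 0 0] by simp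
  have g_sum: "g (sum p {0..n}) w = (\<Sum>i=0..n. g (p i) w)" for p w and n :: nat
    by (induction n) (simp_all add: add)
  have h_sum: "h w (sum p {0..n}) = (\<Sum>i=0..n. h w (p i))" for p w and n :: nat
    by (induction n) (simp_all add: add)
  show ?thesis
  proof (rule fps_ext)
    fix n
    have "(\<Sum>j=0..n. \<Sum>i=0..j. h (x $ i) (k (y $ (j - i)) (z $ (n - j)))) =
          (\<Sum>j=0..n. \<Sum>i=0..n - j. h (x $ j) (k (y $ i) (z $ (n - j - i))))"
      by (rule fps_mult_assoc_lemma)
    then show "fps_bilin g (fps_bilin f x y) z $ n = fps_bilin h x (fps_bilin k y z) $ n"
      by (simp add: fps_bilin_nth g_sum h_sum assoc)
  qed
qed

lemma fps_bilin_commute: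
  "fps_bilin f x y = fps_bilin (\<lambda>b a. f a b) y x"
  unfolding fps_eq_iff fps_bilin_nth
  by (intro allI, subst fps_mult_commute_lemma) (auto intro!: sum.cong)

lemma fps_bilin_add:
  assumes "\<And>x y z. f (x + y) z = f x z + f y z"
  shows "fps_bilin f (x + y) z = fps_bilin f x z + fps_bilin f y z"
  by (simp add: fps_eq_iff fps_bilin_nth assms sum.distrib)

lemma fps_bilin_add':
  assumes "\<And>x y z. f x (y + z) = f x y + f x z"
  shows "fps_bilin f x (y + z) = fps_bilin f x y + fps_bilin f x z"
  by (simp add: fps_eq_iff fps_bilin_nth assms sum.distrib)

lemma (in module) module_fps: "module (fps_bilin scale)"
proof
  show "fps_bilin scale a (x + y) = fps_bilin scale a x + fps_bilin scale a y" for a x y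
    by (rule fps_bilin_add') (rule scale_right_distrib)
  show "fps_bilin scale (a + b) x = fps_bilin scale a x + fps_bilin scale b x" for a b x
    by (rule fps_bilin_add) (rule scale_left_distrib)
  have "fps_bilin scale (fps_bilin (*) a b) x = fps_bilin scale a (fps_bilin scale b x)" for a b x
    by (rule fps_bilin_assoc) (simp_all add: algebra_simps)
  then show "fps_bilin scale a (fps_bilin scale b x) = fps_bilin scale (a * b) x" for a b x
    by (simp add: fps_bilin_times)
  have "(\<Sum>i=0..n. scale (if i = 0 then 1 else 0) (x $ (n - i))) = x $ n" for x n
    by (subst sum.remove[of _ 0]) (auto intro!: sum.neutral)
  then show "fps_bilin scale 1 x = x" for x
    by (simp add: fps_eq_iff fps_bilin_nth)
qed

lemma (in algebra_bimodule) algebra_bimodule_fps: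
  "algebra_bimodule (fps_bilin sclA) (fps_bilin sclM) (fps_bilin lact) (fps_bilin ract)"
proof (intro algebra_bimodule.intro assoc_algebra.intro assoc_algebra_axioms.intro
    algebra_bimodule_axioms.intro alg.module_fps mdl.module_fps)
  note additive = distrib_left distrib_right alg.scale_left_distrib alg.scale_right_distrib
    mdl.scale_left_distrib mdl.scale_right_distrib
    lact_add_left lact_add_right ract_add_left ract_add_right
  note rules = alg.scl_mult_left alg.scl_mult_right lact_scl_left lact_scl_right ract_scl_left
    ract_scl_right
  show A1: "fps_bilin sclA c x * y = fps_bilin sclA c (x * y)" for c x y
    unfolding fps_bilin_times[symmetric] by (rule fps_bilin_assoc) (simp_all add: additive rules)
  have "fps_bilin (*) x (fps_bilin sclA c y) = fps_bilin (*) (fps_bilin (\<lambda>x c. sclA c x) x c) y"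
    for x c y
    by (rule fps_bilin_assoc[symmetric]) (simp_all add: additive rules)
  then show "x * fps_bilin sclA c y = fps_bilin sclA c (x * y)" for x c y
    using A1 by (simp add: fps_bilin_times fps_bilin_commute[of sclA])
  show "fps_bilin lact (a + b) u = fps_bilin lact a u + fps_bilin lact b u" for a b u
    by (rule fps_bilin_add) (rule additive)
  show "fps_bilin lact a (u + v) = fps_bilin lact a u + fps_bilin lact a v" for a u v
    by (rule fps_bilin_add') (rule additive)
  show L1: "fps_bilin lact (fps_bilin sclA c a) u = fps_bilin sclM c (fps_bilin lact a u)" for c a u
    by (rule fps_bilin_assoc) (simp_all add: additive rules)
  have "fps_bilin lact a (fps_bilin sclM c u) = fps_bilin lact (fps_bilin (\<lambda>x c. sclA c x) a c) u"
    for a c u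
    by (rule fps_bilin_assoc[symmetric]) (simp_all add: additive rules)
  then show "fps_bilin lact a (fps_bilin sclM c u) = fps_bilin sclM c (fps_bilin lact a u)" for a c u
    using L1 by (simp add: fps_bilin_commute[of sclA])
  show "fps_bilin ract (u + v) a = fps_bilin ract u a + fps_bilin ract v a" for u v a
    by (rule fps_bilin_add) (rule additive)
  show "fps_bilin ract u (a + b) = fps_bilin ract u a + fps_bilin ract u b" for u a b
    by (rule fps_bilin_add') (rule additive)
  show R1: "fps_bilin ract (fps_bilin sclM c u) a = fps_bilin sclM c (fps_bilin ract u a)" for c u a
    by (rule fps_bilin_assoc) (simp_all add: additive rules)
  have "fps_bilin ract u (fps_bilin sclA c a) = fps_bilin ract (fps_bilin (\<lambda>x c. sclM c x) u c) a"
    for u c a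
    by (rule fps_bilin_assoc[symmetric]) (simp_all add: additive rules)
  then show "fps_bilin ract u (fps_bilin sclA c a) = fps_bilin sclM c (fps_bilin ract u a)" for u c a
    using R1 by (simp add: fps_bilin_commute[of sclM])
  show "fps_bilin lact (a * b) u = fps_bilin lact a (fps_bilin lact b u)" for a b u
    unfolding fps_bilin_times[symmetric] by (rule fps_bilin_assoc) (simp_all add: additive lact_mult)
  show "fps_bilin ract u (a * b) = fps_bilin ract (fps_bilin ract u a) b" for u a b
    unfolding fps_bilin_times[symmetric]
    by (rule fps_bilin_assoc[symmetric]) (simp_all add: additive ract_mult)
  show "fps_bilin ract (fps_bilin lact a u) b = fps_bilin lact a (fps_bilin ract u b)" for a u b
    by (rule fps_bilin_assoc) (simp_all add: additive lact_ract)
qed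


section \<open>Formal one-parameter deformations\<close>

definition formal_deformation ::
    "('k::comm_ring_1 \<Rightarrow> 'a::ring \<Rightarrow> 'a) \<Rightarrow> ('k \<Rightarrow> 'm::ab_group_add \<Rightarrow> 'm) \<Rightarrow>
     ('a \<Rightarrow> 'm \<Rightarrow> 'm) \<Rightarrow> ('m \<Rightarrow> 'a \<Rightarrow> 'm) \<Rightarrow> ('m \<Rightarrow> 'a) \<Rightarrow> ('m \<Rightarrow> 'a) \<Rightarrow>
     ('m \<Rightarrow> 'a) fps \<Rightarrow> ('m \<Rightarrow> 'a) fps \<Rightarrow> bool"
  where "formal_deformation sclA sclM lact ract R S Rt St \<longleftrightarrow>
    (\<forall>i. module_hom sclM sclA (Rt $ i)) \<and> (\<forall>i. module_hom sclM sclA (St $ i)) \<and>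
    Rt $ 0 = R \<and> St $ 0 = S \<and>
    grb_system (fps_bilin sclA) (fps_bilin sclM) (fps_bilin lact) (fps_bilin ract)
      (fps_ext Rt) (fps_ext St)"

definition equivalent_deformations ::
    "('k::comm_ring_1 \<Rightarrow> 'a::ring \<Rightarrow> 'a) \<Rightarrow> ('k \<Rightarrow> 'm::ab_group_add \<Rightarrow> 'm) \<Rightarrow>
     ('a \<Rightarrow> 'm \<Rightarrow> 'm) \<Rightarrow> ('m \<Rightarrow> 'a \<Rightarrow> 'm) \<Rightarrow>
     ('m \<Rightarrow> 'a) fps \<Rightarrow> ('m \<Rightarrow> 'a) fps \<Rightarrow> ('m \<Rightarrow> 'a) fps \<Rightarrow> ('m \<Rightarrow> 'a) fps \<Rightarrow> bool"
  where "equivalent_deformations sclA sclM lact ract Rt St Rt' St' \<longleftrightarrow>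
    (\<exists>a b \<phi>t \<phi>t' \<psi>t.
      \<phi>t $ 0 = (\<lambda>x. x) \<and> \<phi>t $ 1 = (\<lambda>x. a * x - x * a) \<and>
      \<phi>t' $ 0 = (\<lambda>x. x) \<and> \<phi>t' $ 1 = (\<lambda>x. b * x - x * b) \<and>
      \<psi>t $ 0 = (\<lambda>u. u) \<and> \<psi>t $ 1 = (\<lambda>u. lact a u - ract u b) \<and>
      (\<forall>i\<ge>2. module_hom sclA sclA (\<phi>t $ i) \<and> module_hom sclA sclA (\<phi>t' $ i) \<and>
        module_hom sclM sclM (\<psi>t $ i)) \<and>
      grb_morphism
        (fps_bilin sclA) (fps_bilin sclM) (fps_bilin lact) (fps_bilin ract) (fps_ext Rt) (fps_ext St)
        (fps_bilin sclA) (fps_bilin sclM) (fps_bilin lact) (fps_bilin ract) (fps_ext Rt') (fps_ext St')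
        (fps_ext \<phi>t) (fps_ext \<phi>t') (fps_ext \<psi>t))"


section \<open>Cohomology\<close>

text \<open>
  An element of \<open>Hom(M\<^sup>\<otimes>\<^sup>n, A \<oplus> A)\<close> is a function on lists that is linear in each entry on the
  lists of length \<open>n\<close> and zero on all other lists, so that equality of cochains is equality
  of functions. For \<open>n = 0\<close> only the value at the empty list is free.
\<close>

definition cochains ::
    "('k::comm_ring_1 \<Rightarrow> 'a::ring \<Rightarrow> 'a) \<Rightarrow> ('k \<Rightarrow> 'm::ab_group_add \<Rightarrow> 'm) \<Rightarrow> nat \<Rightarrow>
     ('m list \<Rightarrow> 'a \<times> 'a) set"
  where "cochains sclA sclM n = {F.
    (\<forall>xs ys. length xs + 1 + length ys = n \<longrightarrow>
      module_hom sclM sclA (\<lambda>u. fst (F (xs @ u # ys))) \<and>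
      module_hom sclM sclA (\<lambda>u. snd (F (xs @ u # ys)))) \<and>
    (\<forall>us. length us \<noteq> n \<longrightarrow> F us = 0)}"

text \<open>
  The two insertion sums of the bracket, for \<open>F\<close> of arity \<open>m\<close> and \<open>G\<close> of arity \<open>n\<close>. The
  projection \<open>p\<close> selects the component of the outer cochain. Since \<^term>\<open>us ! 0\<close> is the first
  entry, \<open>u\<^sub>i\<close> is \<^term>\<open>us ! (i - 1)\<close>. Signs act through the scalars, as the
  algebra may lack a unit.
\<close>

definition insertion_sum ::
    "('k::comm_ring_1 \<Rightarrow> 'a::ring \<Rightarrow> 'a) \<Rightarrow> ('a \<Rightarrow> 'm \<Rightarrow> 'm) \<Rightarrow> ('m \<Rightarrow> 'a \<Rightarrow> 'm) \<Rightarrow>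
     ('a \<times> 'a \<Rightarrow> 'a) \<Rightarrow> nat \<Rightarrow> nat \<Rightarrow> ('m list \<Rightarrow> 'a \<times> 'a) \<Rightarrow> ('m list \<Rightarrow> 'a \<times> 'a) \<Rightarrow>
     'm list \<Rightarrow> 'a"
  where "insertion_sum sclA lact ract p m n F G us =
    (\<Sum>i=1..m. sclA ((-1) ^ ((i - 1) * n))
      (p (F (take (i - 1) us @
        [lact (fst (G (take n (drop (i - 1) us)))) (us ! (i - 1 + n))] @ drop (i + n) us)))) -
    (\<Sum>i=1..m. sclA ((-1) ^ (i * n))
      (p (F (take (i - 1) us @
        [ract (us ! (i - 1)) (snd (G (take n (drop i us))))] @ drop (i + n) us))))"

definition bracket_component ::
    "('k::comm_ring_1 \<Rightarrow> 'a::ring \<Rightarrow> 'a) \<Rightarrow> ('a \<Rightarrow> 'm \<Rightarrow> 'm) \<Rightarrow> ('m \<Rightarrow> 'a \<Rightarrow> 'm) \<Rightarrow>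
     ('a \<times> 'a \<Rightarrow> 'a) \<Rightarrow> nat \<Rightarrow> nat \<Rightarrow> ('m list \<Rightarrow> 'a \<times> 'a) \<Rightarrow> ('m list \<Rightarrow> 'a \<times> 'a) \<Rightarrow>
     'm list \<Rightarrow> 'a"
  where "bracket_component sclA lact ract p m n F G us =
    insertion_sum sclA lact ract p m n F G us -
    sclA ((-1) ^ (m * n)) (insertion_sum sclA lact ract p n m G F us) +
    sclA ((-1) ^ (m * n))
      (p (F (take m us)) * p (G (drop m us)) -
       sclA ((-1) ^ (m * n)) (p (G (take n us)) * p (F (drop n us))))"

definition grb_bracket ::
    "('k::comm_ring_1 \<Rightarrow> 'a::ring \<Rightarrow> 'a) \<Rightarrow> ('a \<Rightarrow> 'm \<Rightarrow> 'm) \<Rightarrow> ('m \<Rightarrow> 'a \<Rightarrow> 'm) \<Rightarrow>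
     nat \<Rightarrow> nat \<Rightarrow> ('m list \<Rightarrow> 'a \<times> 'a) \<Rightarrow> ('m list \<Rightarrow> 'a \<times> 'a) \<Rightarrow> ('m list \<Rightarrow> 'a \<times> 'a)"
  where "grb_bracket sclA lact ract m n F G = (\<lambda>us.
    if length us = m + n
    then (bracket_component sclA lact ract fst m n F G us,
          bracket_component sclA lact ract snd m n F G us)
    else 0)"

text \<open>A pair of maps, regarded as a cochain of degree one.\<close>

definition cochain_of_pair :: "('m \<Rightarrow> 'a::ring) \<Rightarrow> ('m \<Rightarrow> 'a) \<Rightarrow> 'm list \<Rightarrow> 'a \<times> 'a"
  where "cochain_of_pair R S = (\<lambda>us. if length us = 1 then (R (us ! 0), S (us ! 0)) else 0)"

definition grb_differential ::
    "('k::comm_ring_1 \<Rightarrow> 'a::ring \<Rightarrow> 'a) \<Rightarrow> ('a \<Rightarrow> 'm \<Rightarrow> 'm) \<Rightarrow> ('m \<Rightarrow> 'a \<Rightarrow> 'm) \<Rightarrow>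
     ('m \<Rightarrow> 'a) \<Rightarrow> ('m \<Rightarrow> 'a) \<Rightarrow> nat \<Rightarrow> ('m list \<Rightarrow> 'a \<times> 'a) \<Rightarrow> ('m list \<Rightarrow> 'a \<times> 'a)"
  where "grb_differential sclA lact ract R S n F =
    grb_bracket sclA lact ract 1 n (cochain_of_pair R S) F"

definition cocycles ::
    "('k::comm_ring_1 \<Rightarrow> 'a::ring \<Rightarrow> 'a) \<Rightarrow> ('k \<Rightarrow> 'm::ab_group_add \<Rightarrow> 'm) \<Rightarrow>
     ('a \<Rightarrow> 'm \<Rightarrow> 'm) \<Rightarrow> ('m \<Rightarrow> 'a \<Rightarrow> 'm) \<Rightarrow> ('m \<Rightarrow> 'a) \<Rightarrow> ('m \<Rightarrow> 'a) \<Rightarrow> nat \<Rightarrow>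
     ('m list \<Rightarrow> 'a \<times> 'a) set"
  where "cocycles sclA sclM lact ract R S n =
    {F \<in> cochains sclA sclM n. grb_differential sclA lact ract R S n F = 0}"

fun coboundaries ::
    "('k::comm_ring_1 \<Rightarrow> 'a::ring \<Rightarrow> 'a) \<Rightarrow> ('k \<Rightarrow> 'm::ab_group_add \<Rightarrow> 'm) \<Rightarrow>
     ('a \<Rightarrow> 'm \<Rightarrow> 'm) \<Rightarrow> ('m \<Rightarrow> 'a \<Rightarrow> 'm) \<Rightarrow> ('m \<Rightarrow> 'a) \<Rightarrow> ('m \<Rightarrow> 'a) \<Rightarrow> nat \<Rightarrow>
     ('m list \<Rightarrow> 'a \<times> 'a) set"
  where
    "coboundaries sclA sclM lact ract R S 0 = {0}"
  | "coboundaries sclA sclM lact ract R S (Suc n) =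
      grb_differential sclA lact ract R S n ` cochains sclA sclM n"

text \<open>Cohomology classes are the cosets of the group of coboundaries.\<close>

definition cohomology_class ::
    "('k::comm_ring_1 \<Rightarrow> 'a::ring \<Rightarrow> 'a) \<Rightarrow> ('k \<Rightarrow> 'm::ab_group_add \<Rightarrow> 'm) \<Rightarrow>
     ('a \<Rightarrow> 'm \<Rightarrow> 'm) \<Rightarrow> ('m \<Rightarrow> 'a \<Rightarrow> 'm) \<Rightarrow> ('m \<Rightarrow> 'a) \<Rightarrow> ('m \<Rightarrow> 'a) \<Rightarrow> nat \<Rightarrow>
     ('m list \<Rightarrow> 'a \<times> 'a) \<Rightarrow> ('m list \<Rightarrow> 'a \<times> 'a) set"
  where "cohomology_class sclA sclM lact ract R S n F =
    F +o coboundaries sclA sclM lact ract R S n"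

definition cohomology ::
    "('k::comm_ring_1 \<Rightarrow> 'a::ring \<Rightarrow> 'a) \<Rightarrow> ('k \<Rightarrow> 'm::ab_group_add \<Rightarrow> 'm) \<Rightarrow>
     ('a \<Rightarrow> 'm \<Rightarrow> 'm) \<Rightarrow> ('m \<Rightarrow> 'a \<Rightarrow> 'm) \<Rightarrow> ('m \<Rightarrow> 'a) \<Rightarrow> ('m \<Rightarrow> 'a) \<Rightarrow> nat \<Rightarrow>
     ('m list \<Rightarrow> 'a \<times> 'a) set set"
  where "cohomology sclA sclM lact ract R S n =
    cohomology_class sclA sclM lact ract R S n ` cocycles sclA sclM lact ract R S n"

definition infinitesimal :: "('m \<Rightarrow> 'a::ring) fps \<Rightarrow> ('m \<Rightarrow> 'a) fps \<Rightarrow> 'm list \<Rightarrow> 'a \<times> 'a"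
  where "infinitesimal Rt St = cochain_of_pair (Rt $ 1) (St $ 1)"

end

theory Submission
  imports Defs
begin

text \<open>
  Everything is read off from the coefficients of \<open>t\<close> at constant power series. For the
  Rota-Baxter identities this coefficient is the cocycle condition on \<open>(R\<^sub>1, S\<^sub>1)\<close>. For the
  relations \<open>R'\<^sub>t \<circ> \<psi>\<^sub>t = \<phi>\<^sub>t \<circ> R\<^sub>t\<close> and \<open>S'\<^sub>t \<circ> \<psi>\<^sub>t = \<phi>'\<^sub>t \<circ> S\<^sub>t\<close> it says that
  \<open>(R\<^sub>1, S\<^sub>1) - (R'\<^sub>1, S'\<^sub>1)\<close> is the differential of the \<open>0\<close>-cochain \<open>(a, b)\<close>.
\<close>

lemma fps_bilin_nth_0: "fps_bilin f x y $ 0 = f (x $ 0) (y $ 0)"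
  by (simp add: fps_bilin_nth)

lemma fps_bilin_nth_1: "fps_bilin f x y $ 1 = f (x $ 0) (y $ 1) + f (x $ 1) (y $ 0)"
  by (simp add: fps_bilin_nth)

lemma fps_ext_nth_0: "fps_ext F x $ 0 = (F $ 0) (x $ 0)"
  by (simp add: fps_ext_nth)

lemma fps_ext_nth_1: "fps_ext F x $ 1 = (F $ 0) (x $ 1) + (F $ 1) (x $ 0)"
  by (simp add: fps_ext_nth)

lemma cochain_of_pair_add:
  "cochain_of_pair f g + cochain_of_pair f' g' =
    cochain_of_pair (\<lambda>u. f u + f' u) (\<lambda>u. g u + g' u)"
  by (auto simp: cochain_of_pair_def fun_eq_iff)

lemma cochain_of_pair_in_cochains:
  assumes "module_hom sclM sclA f" "module_hom sclM sclA g"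
  shows "cochain_of_pair f g \<in> cochains sclA sclM 1"
  using assms by (auto simp: cochains_def cochain_of_pair_def)

context grb_system
begin

sublocale R: module_hom sclM sclA R
  by (rule linear_R)

sublocale S: module_hom sclM sclA S
  by (rule linear_S)

lemma lact_zero_right: "lact a 0 = 0"
  using lact_add_right[of a 0 0] by simp

lemma ract_zero_left: "ract 0 a = 0"
  using ract_add_left[of 0 0 a] by simp

text \<open>Both components are the derivative at \<open>(R, S)\<close>, in the direction
  \<open>(f, g)\<close>, of the defect of a Rota-Baxter identity, that is of
  \<open>R w - R u * R v\<close> and \<open>S w - S u * S v\<close>, where \<open>w\<close> varies
  with \<open>(R, S)\<close> too. All the sign exponents that survive for \<open>m = n = 1\<close>
  are 0 or 1, and additivity merges the two insertion terms of each map.\<close>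

lemma grb_differential_pair:
  assumes f: "module_hom sclM sclA f" and g: "module_hom sclM sclA g" and "length us = 2"
  shows "grb_differential sclA lact ract R S 1 (cochain_of_pair f g) us =
    (let u = us ! 0; v = us ! 1; w = lact (R u) v + ract u (S v) in
      (R (lact (f u) v + ract u (g v)) + f w - (R u * f v + f u * R v),
       S (lact (f u) v + ract u (g v)) + g w - (S u * g v + g u * S v)))"
proof -
  interpret f: module_hom sclM sclA f by (rule f)
  interpret g: module_hom sclM sclA g by (rule g)
  obtain u v where "us = [u, v]"
    using assms(3) by (auto simp: numeral_2_eq_2 length_Suc_conv)
  then show ?thesis
    by (simp add: grb_differential_def grb_bracket_def bracket_component_def insertion_sum_def
        cochain_of_pair_def Let_def R.add S.add f.add g.add algebra_simps)
qed

lemma deformation_coeff_1: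
  assumes "formal_deformation sclA sclM lact ract R S Rt St"
  shows "R u * (Rt $ 1) v + (Rt $ 1) u * R v =
      R (lact ((Rt $ 1) u) v + ract u ((St $ 1) v)) + (Rt $ 1) (lact (R u) v + ract u (S v))"
    and "S u * (St $ 1) v + (St $ 1) u * S v =
      S (lact ((Rt $ 1) u) v + ract u ((St $ 1) v)) + (St $ 1) (lact (R u) v + ract u (S v))"
proof -
  have zero: "Rt $ 0 = R" "St $ 0 = S"
    using assms by (auto simp: formal_deformation_def)
  interpret t: grb_system "fps_bilin sclA" "fps_bilin sclM" "fps_bilin lact" "fps_bilin ract"
      "fps_ext Rt" "fps_ext St"
    using assms by (simp add: formal_deformation_def)
  \<comment> \<open>At \<open>fps_const u\<close> and \<open>fps_const v\<close> the terms that
    contain a coefficient of \<open>t\<close> of an argument vanish, because the maps and the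
    actions send 0 to 0. What remains of order one comes from \<open>Rt $ 1\<close> and
    \<open>St $ 1\<close>.\<close>
  note coeff = fps_mult_nth_1 fps_bilin_nth_0 fps_bilin_nth_1[simplified]
    fps_ext_nth_0 fps_ext_nth_1[simplified] zero lact_zero_right ract_zero_left
  show "R u * (Rt $ 1) v + (Rt $ 1) u * R v =
      R (lact ((Rt $ 1) u) v + ract u ((St $ 1) v)) + (Rt $ 1) (lact (R u) v + ract u (S v))"
    using arg_cong[OF t.R_mult[of "fps_const u" "fps_const v"], of "\<lambda>x. x $ 1"]
    by (simp add: coeff)
  show "S u * (St $ 1) v + (St $ 1) u * S v =
      S (lact ((Rt $ 1) u) v + ract u ((St $ 1) v)) + (St $ 1) (lact (R u) v + ract u (S v))"
    using arg_cong[OF t.S_mult[of "fps_const u" "fps_const v"], of "\<lambda>x. x $ 1"]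
    by (simp add: coeff)
qed

lemma infinitesimal_cocycle:
  assumes "formal_deformation sclA sclM lact ract R S Rt St"
  shows "infinitesimal Rt St \<in> cocycles sclA sclM lact ract R S 1"
proof -
  have hom: "module_hom sclM sclA (Rt $ 1)" "module_hom sclM sclA (St $ 1)"
    using assms by (auto simp: formal_deformation_def)
  have "grb_differential sclA lact ract R S 1 (cochain_of_pair (Rt $ 1) (St $ 1)) us = 0" for us
  proof (cases "length us = 2")
    case True
    show ?thesis
      unfolding grb_differential_pair[OF hom True] Let_def deformation_coeff_1[OF assms]
      by (simp add: zero_prod_def)
  next
    \<comment> \<open>The bracket of two cochains of arity one is set to 0 off the lists of length
      two.\<close>
    case False
    then show ?thesis by (simp add: grb_differential_def grb_bracket_def)
  qed
  then show ?thesis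
    unfolding cocycles_def infinitesimal_def
    using cochain_of_pair_in_cochains[OF hom] by (simp add: fun_eq_iff)
qed

text \<open>The differential of a \<open>0\<close>-cochain in closed form. Such a cochain amounts to
  its value \<open>(a, b)\<close> at the empty list, so pairs serve as the index set.\<close>

definition inner_coboundary :: "'a \<times> 'a \<Rightarrow> 'm list \<Rightarrow> 'a \<times> 'a"
  where "inner_coboundary c = (case c of (a, b) \<Rightarrow> cochain_of_pair
    (\<lambda>u. R (lact a u - ract u b) + R u * a - a * R u)
    (\<lambda>u. S (lact a u - ract u b) + S u * b - b * S u))"

lemma inner_coboundary_add:
  "inner_coboundary (c + d) = inner_coboundary c + inner_coboundary d"
proof -
  obtain a b a' b' where c: "c = (a, b)" and d: "d = (a', b')" by fastforce
  have "lact (a + a') u - ract u (b + b') = (lact a u - ract u b) + (lact a' u - ract u b')" for u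
    by (simp add: lact_add_left ract_add_right)
  then have "R (lact (a + a') u - ract u (b + b')) =
      R (lact a u - ract u b) + R (lact a' u - ract u b')"
    and "S (lact (a + a') u - ract u (b + b')) =
      S (lact a u - ract u b) + S (lact a' u - ract u b')" for u
    by (simp_all only: R.add S.add)
  then show ?thesis
    by (simp add: inner_coboundary_def c d cochain_of_pair_add algebra_simps)
qed

text \<open>For \<open>m = 1\<close> and \<open>n = 0\<close> every sign is 1 and the insertions
  into \<open>F\<close> form an empty sum. The two insertions into \<open>(R, S)\<close> and the
  commutator with \<open>F []\<close> remain.\<close>

lemma grb_differential_0:
  "grb_differential sclA lact ract R S 0 F = inner_coboundary (F [])"
proof
  fix us
  show "grb_differential sclA lact ract R S 0 F us = inner_coboundary (F []) us"
  proof (cases "length us = 1")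
    case True
    then obtain u where "us = [u]" by (auto simp: length_Suc_conv)
    then show ?thesis
      by (simp add: grb_differential_def grb_bracket_def bracket_component_def insertion_sum_def
          cochain_of_pair_def inner_coboundary_def R.diff S.diff split: prod.split)
  next
    case False
    then show ?thesis
      by (simp add: grb_differential_def grb_bracket_def cochain_of_pair_def inner_coboundary_def
          split: prod.split)
  qed
qed

lemma coboundaries_1: "coboundaries sclA sclM lact ract R S 1 = range inner_coboundary"
proof -
  \<comment> \<open>In arity 0 there is no entry in which linearity could be demanded, so any value
    \<open>c\<close> at the empty list gives a cochain.\<close>
  have "(\<lambda>us. if us = [] then c else 0) \<in> cochains sclA sclM 0" for c
    by (simp add: cochains_def)
  then have "c \<in> (\<lambda>F. F []) ` cochains sclA sclM 0" for c
    by (rule rev_image_eqI) simp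
  then have "(\<lambda>F. F []) ` cochains sclA sclM 0 = UNIV" by blast
  then show ?thesis
    using image_image[of inner_coboundary "\<lambda>F. F []" "cochains sclA sclM 0"]
    by (simp add: grb_differential_0)
qed

lemma cohomology_class_add_inner_coboundary:
  "cohomology_class sclA sclM lact ract R S 1 (F + inner_coboundary c) =
    cohomology_class sclA sclM lact ract R S 1 F"
proof -
  \<comment> \<open>Translation by \<open>c\<close> permutes the index set. By additivity the
    coboundaries therefore absorb \<open>inner_coboundary c\<close>, which makes the two cosets
    equal.\<close>
  have "range inner_coboundary = inner_coboundary ` range ((+) c)"
    by simp
  also have "\<dots> = (+) (inner_coboundary c) ` range inner_coboundary"
    by (simp only: image_image inner_coboundary_add)
  finally have "(+) F ` range inner_coboundary =
      (+) F ` (+) (inner_coboundary c) ` range inner_coboundary"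
    by (rule arg_cong)
  also have "\<dots> = (+) (F + inner_coboundary c) ` range inner_coboundary"
    by (simp only: image_image add.assoc)
  finally show ?thesis
    unfolding cohomology_class_def coboundaries_1
    by (auto simp: elt_set_plus_def image_def)
qed

text \<open>The linear terms of \<open>\<phi>t\<close>, \<open>\<phi>t'\<close> and
  \<open>\<psi>t\<close> are all governed by one pair \<open>(a, b)\<close>, and this pair is the
  witness \<open>c\<close>.\<close>

lemma equivalent_deformations_infinitesimal:
  assumes deform: "formal_deformation sclA sclM lact ract R S Rt St"
    and deform': "formal_deformation sclA sclM lact ract R S Rt' St'"
    and equiv: "equivalent_deformations sclA sclM lact ract Rt St Rt' St'"
  obtains c where "infinitesimal Rt St = infinitesimal Rt' St' + inner_coboundary c"
proof -
  obtain a b \<phi>t \<phi>t' \<psi>t where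
    eqs: "\<phi>t $ 0 = (\<lambda>x. x)" "\<phi>t $ 1 = (\<lambda>x. a * x - x * a)"
      "\<phi>t' $ 0 = (\<lambda>x. x)" "\<phi>t' $ 1 = (\<lambda>x. b * x - x * b)"
      "\<psi>t $ 0 = (\<lambda>u. u)" "\<psi>t $ 1 = (\<lambda>u. lact a u - ract u b)"
    and mor: "grb_morphism
        (fps_bilin sclA) (fps_bilin sclM) (fps_bilin lact) (fps_bilin ract) (fps_ext Rt) (fps_ext St)
        (fps_bilin sclA) (fps_bilin sclM) (fps_bilin lact) (fps_bilin ract) (fps_ext Rt') (fps_ext St')
        (fps_ext \<phi>t) (fps_ext \<phi>t') (fps_ext \<psi>t)"
    using equiv unfolding equivalent_deformations_def by blast
  have zero: "Rt $ 0 = R" "St $ 0 = S" "Rt' $ 0 = R" "St' $ 0 = S"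
    using deform deform' by (auto simp: formal_deformation_def)
  note coeff = fps_ext_nth_0 fps_ext_nth_1[simplified] zero eqs[simplified]
  \<comment> \<open>On the left, \<open>R\<close> is applied to \<open>\<psi>t $ 1\<close>, the
    linear term of \<open>\<psi>t\<close>; on the right, the commutator with \<open>a\<close> is
    applied to \<open>R u\<close>. Moving the commutator across gives the first component of
    \<open>inner_coboundary (a, b)\<close>.\<close>
  have "(Rt' $ 1) u + R (lact a u - ract u b) = (Rt $ 1) u + (a * R u - R u * a)" for u
    using arg_cong[OF grb_morphism.R_psi[OF mor, of "fps_const u"], of "\<lambda>x. x $ 1"]
    by (simp add: coeff add.commute)
  then have eq: "Rt $ 1 = (\<lambda>u. (Rt' $ 1) u + (R (lact a u - ract u b) + R u * a - a * R u))"
    by (simp add: fun_eq_iff algebra_simps)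
  have "(St' $ 1) u + S (lact a u - ract u b) = (St $ 1) u + (b * S u - S u * b)" for u
    using arg_cong[OF grb_morphism.S_psi[OF mor, of "fps_const u"], of "\<lambda>x. x $ 1"]
    by (simp add: coeff add.commute)
  then have eq': "St $ 1 = (\<lambda>u. (St' $ 1) u + (S (lact a u - ract u b) + S u * b - b * S u))"
    by (simp add: fun_eq_iff algebra_simps)
  have "infinitesimal Rt St = infinitesimal Rt' St' + inner_coboundary (a, b)"
    unfolding infinitesimal_def inner_coboundary_def prod.case cochain_of_pair_add
    using eq eq' by simp
  then show ?thesis by (rule that)
qed

end

theorem theorem4p3:
  fixes sclA :: "'k::field_char_0 \<Rightarrow> 'a::ring \<Rightarrow> 'a"
    and sclM :: "'k \<Rightarrow> 'm::ab_group_add \<Rightarrow> 'm"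
    and lact :: "'a \<Rightarrow> 'm \<Rightarrow> 'm" and ract :: "'m \<Rightarrow> 'a \<Rightarrow> 'm"
    and R S :: "'m \<Rightarrow> 'a"
  assumes "grb_system sclA sclM lact ract R S"
  shows "(\<forall>Rt St. formal_deformation sclA sclM lact ract R S Rt St \<longrightarrow>
           infinitesimal Rt St \<in> cocycles sclA sclM lact ract R S 1) \<and>
         (\<forall>Rt St Rt' St'. formal_deformation sclA sclM lact ract R S Rt St \<longrightarrow>
           formal_deformation sclA sclM lact ract R S Rt' St' \<longrightarrow>
           equivalent_deformations sclA sclM lact ract Rt St Rt' St' \<longrightarrow>
           cohomology_class sclA sclM lact ract R S 1 (infinitesimal Rt St) \<in>
             cohomology sclA sclM lact ract R S 1 \<and>
           cohomology_class sclA sclM lact ract R S 1 (infinitesimal Rt St) =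
           cohomology_class sclA sclM lact ract R S 1 (infinitesimal Rt' St'))"
proof -
  interpret grb_system sclA sclM lact ract R S by (rule assms)
  have "cohomology_class sclA sclM lact ract R S 1 (infinitesimal Rt St) =
      cohomology_class sclA sclM lact ract R S 1 (infinitesimal Rt' St')"
    if deform: "formal_deformation sclA sclM lact ract R S Rt St"
      "formal_deformation sclA sclM lact ract R S Rt' St'"
      "equivalent_deformations sclA sclM lact ract Rt St Rt' St'" for Rt St Rt' St'
  proof -
    obtain c where "infinitesimal Rt St = infinitesimal Rt' St' + inner_coboundary c"
      using equivalent_deformations_infinitesimal[OF deform] .
    then show ?thesis
      by (simp only: cohomology_class_add_inner_coboundary)
  qed
  \<comment> \<open>The class lies in \<open>cohomology\<close> because that set is the image of the
    cocycles, and the infinitesimal is one of them.\<close>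
  then show ?thesis
    unfolding cohomology_def using infinitesimal_cocycle by blast
qed

end
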